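(* Each of the numbers $41, 43, 59, 67, 82, 83, 85, 86, 89, 91, 97$ is an $ndh$-number, i.e. none of them can be written as $h-k$ with $h,k$ harmonic numbers.
   Context: A harmonic number is a positive integer of the form $2^a3^b$ with $a,b\ge 0$ integers (so $1$ is harmonic). A positive integer is an $ndh$-number if it cannot be written as a difference $h-k$ of two harmonic numbers $h,k$. *)

theory Defs
  imports Main
begin

definition harmonic_number :: "nat \<Rightarrow> bool" where
  "harmonic_number n \<longleftrightarrow> (\<exists>a b. n = 2 ^ a * 3 ^ b)"

(* The difference is taken in int, since subtraction on nat truncates. *)
definition ndh_number :: "nat \<Rightarrow> bool" where
  "ndh_number n \<longleftrightarrow> n > 0 \<and>
     \<not> (\<exists>h k. harmonic_number h \<and> harmonic_number k \<and> int n = int h - int k)"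

end

theory Submission
  imports Defs
begin

text \<open>Let \<open>2^a * 3^b - 2^c * 3^d = n\<close> with \<open>n\<close> coprime to 6. Then one of \<open>a, c\<close> and one of
  \<open>b, d\<close> vanish, so \<open>n\<close> is \<open>2^a - 3^d\<close>, \<open>3^b - 2^c\<close>, or one less than a harmonic number.
  The first two are excluded modulo 240, where the powers of 2 take only the values
  \<open>1, 2, 4, \<dots>, 128\<close> and the powers of 3 only \<open>1, 3, 9, 27, 81\<close>; the third is a finite check. The numbers \<open>82 = 2 * 41\<close> and
  \<open>86 = 2 * 43\<close> reduce to \<open>41\<close> and \<open>43\<close> when \<open>h, k\<close> are both even, and differences of two
  powers of 3 are again excluded modulo 240.\<close>

text \<open>The list closes under doubling because 2 * 128 = 256 is 16 modulo 240. As 240 = 16 * 15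
  = 3 * 80, both powers of 2 and powers of 3 soon have period 4.\<close>

lemma power2_mod_240: "(2::nat) ^ a mod 240 \<in> {1, 2, 4, 8, 16, 32, 64, 128}"
proof (induction a)
  case (Suc a)
  have "(2::nat) ^ Suc a mod 240 = 2 * (2 ^ a mod 240) mod 240"
    by (simp add: mod_mult_right_eq)
  with Suc show ?case by auto
qed simp

text \<open>Tripling closes up because 3 * 81 = 243 is 3 modulo 240.\<close>

lemma power3_mod_240: "(3::nat) ^ b mod 240 \<in> {1, 3, 9, 27, 81}"
proof (induction b)
  case (Suc b)
  have "(3::nat) ^ Suc b mod 240 = 3 * (3 ^ b mod 240) mod 240"
    by (simp add: mod_mult_right_eq)
  with Suc show ?case by auto
qed simp

lemma ndh_number_iff:
  "ndh_number n \<longleftrightarrow> n > 0 \<and> (\<forall>a b c d. 2 ^ a * 3 ^ b \<noteq> n + 2 ^ c * 3 ^ d)"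
proof -
  have "int n = int h - int k \<longleftrightarrow> h = n + k" for h k by linarith
  then show ?thesis
    unfolding ndh_number_def harmonic_number_def by metis
qed

lemma harmonic_difference_coprime_6:
  fixes n :: nat
  assumes "odd n" "\<not> 3 dvd n" and eq: "2 ^ a * 3 ^ b = n + 2 ^ c * 3 ^ d"
  shows "2 ^ a = n + 3 ^ d \<or> 3 ^ b = n + 2 ^ c \<or> 2 ^ a * 3 ^ b = n + 1"
proof -
  have "even (2 ^ a * 3 ^ b :: nat) \<noteq> even (2 ^ c * 3 ^ d :: nat)"
    using assms(1) eq by simp
  then have 2: "a = 0 \<or> c = 0" by auto
  have "\<not> (3 dvd (2 ^ a * 3 ^ b :: nat) \<and> 3 dvd (2 ^ c * 3 ^ d :: nat))"
    using assms(2) eq by (metis dvd_add_left_iff)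
  then have 3: "b = 0 \<or> d = 0"
    by (metis dvd_mult dvd_power gr0I)
  \<comment> \<open>The right side of \<open>eq\<close> is at least 2, which rules out
    \<open>a = b = 0\<close>, the fourth combination of \<open>2\<close> and
    \<open>3\<close>.\<close>
  have "n > 0" using assms(1) by (auto intro: gr0I)
  moreover have "(2::nat) ^ c * 3 ^ d > 0" by simp
  ultimately have "2 ^ a * 3 ^ b \<noteq> (1::nat)" unfolding eq by linarith
  then have "\<not> (a = 0 \<and> b = 0)" by auto
  then show ?thesis using 2 3 eq by auto
qed

lemma ndh_number_coprime_6:
  assumes "n \<in> {41, 43, 59, 67, 83, 85, 89, 91, 97}"
  shows "ndh_number n"
  unfolding ndh_number_iff
proof (intro conjI allI notI)
  show "n > 0" using assms by auto
  fix a b c d :: nat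
  assume eq: "2 ^ a * 3 ^ b = n + 2 ^ c * 3 ^ d"
  have "odd n" "\<not> 3 dvd n" using assms by auto
  from harmonic_difference_coprime_6[OF this eq] show False
  proof (elim disjE)
    assume "2 ^ a = n + 3 ^ d"
    then have "2 ^ a mod 240 = (n + 3 ^ d mod 240) mod 240"
      by (simp add: mod_add_right_eq)
    then show False
      using assms power2_mod_240[of a] power3_mod_240[of d] by auto
  next
    assume "3 ^ b = n + 2 ^ c"
    then have "3 ^ b mod 240 = (n + 2 ^ c mod 240) mod 240"
      by (simp add: mod_add_right_eq)
    then show False
      using assms power2_mod_240[of c] power3_mod_240[of b] by auto
  next
    assume *: "2 ^ a * 3 ^ b = n + 1"
    \<comment> \<open>Both factors are below 240, hence equal to their residues, so the two residue
      lists leave only 40 products to compare with \<open>n + 1\<close>.\<close>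
    have "(2::nat) ^ a \<le> 2 ^ a * 3 ^ b" "(3::nat) ^ b \<le> 2 ^ a * 3 ^ b" by simp_all
    moreover have "n + 1 < 240" using assms by auto
    ultimately have "(2::nat) ^ a mod 240 = 2 ^ a" "(3::nat) ^ b mod 240 = 3 ^ b"
      unfolding * by simp_all
    then have "(2 ^ a mod 240) * (3 ^ b mod 240) = n + 1"
      using * by simp
    then show False
      using assms power2_mod_240[of a] power3_mod_240[of b] by auto
  qed
qed

lemma ndh_number_double:
  assumes n: "ndh_number n" and odd: "\<And>b d. 3 ^ b \<noteq> 2 * n + 3 ^ d"
  shows "ndh_number (2 * n)"
  unfolding ndh_number_iff
proof (intro conjI allI notI)
  show "2 * n > 0" using n by (simp add: ndh_number_def)
  fix a b c d :: nat
  assume eq: "2 ^ a * 3 ^ b = 2 * n + 2 ^ c * 3 ^ d"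
  then have "even (2 ^ a * 3 ^ b :: nat) = even (2 ^ c * 3 ^ d :: nat)" by simp
  then have "a = 0 \<longleftrightarrow> c = 0" by auto
  then consider "a = 0" "c = 0" | a' c' where "a = Suc a'" "c = Suc c'"
    by (metis not0_implies_Suc)
  then show False
  proof cases
    case 1
    then show False using eq odd by simp
  next
    case 2
    then have "2 ^ a' * 3 ^ b = n + 2 ^ c' * 3 ^ d" using eq by simp
    then show False using n by (auto simp: ndh_number_iff)
  qed
qed

lemma power3_difference_neq:
  assumes "n \<in> {82, 86}"
  shows "(3::nat) ^ b \<noteq> n + 3 ^ d"
proof
  assume "3 ^ b = n + 3 ^ d"
  then have "3 ^ b mod 240 = (n + 3 ^ d mod 240) mod 240"
    by (simp add: mod_add_right_eq)
  then show False
    using assms power3_mod_240[of b] power3_mod_240[of d] by auto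
qed

theorem theorem2p2:
  shows "\<forall>n \<in> {41, 43, 59, 67, 82, 83, 85, 86, 89, 91, 97}. ndh_number n"
proof -
  have "ndh_number (2 * 41)" "ndh_number (2 * 43)"
    by (intro ndh_number_double ndh_number_coprime_6 power3_difference_neq; simp)+
  then show ?thesis using ndh_number_coprime_6 by simp
qed

end
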